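(* Let $\mathcal{X}=\{x\in\mathbb{R}^n:Ax\le a,\ Bx=b\}$ be a polyhedron given by finitely many linear inequalities and equalities, let $\mathcal{L}\subset[m]$ be nonempty with $[m]\setminus\mathcal{L}\neq\emptyset$, and let $f=(f_1,\dots,f_m):\mathbb{R}^n\to\mathbb{R}^m$ where $f_i$ is linear for $i\in\mathcal{L}$ and $f_i$ is $\mu_i$-strongly convex ($\mu_i>0$) and $L_i$-smooth for $i\in[m]\setminus\mathcal{L}$. Consider the problem (LCMOP) $\min_{x\in\mathcal{X}}f(x)$ and the problem (MLP) $\min_{x\in\mathcal{X}}f_{\mathcal{L}}(x)$, where $f_{\mathcal{L}}=(f_i)_{i\in\mathcal{L}}$. Let $\{x^k\}$ be the (infinite) sequence generated from $x^0\in\mathcal{X}$ by the adaptive Barzilai-Borwein proximal gradient method (ABBPGMO, described in the context) applied to (LCMOP), with parameters $\tau>1$ and $0<\alpha_{\min}<\alpha_{\max}$ satisfying $\alpha_{\min}\le\min_{i\in[m]\setminus\mathcal{L}}\mu_i$ and $\alpha_{\max}\ge\max_{i\in[m]\setminus\mathcal{L}}L_i$. Then: (i) $\{x^k\}$ converges to some weakly Pareto solution $x^*$ of (LCMOP). (ii) If $x^*$ is not a weakly Pareto solution of (MLP), then for all $k\ge0$ $$\|x^{k+1}-x^*\|\le\sqrt{1-(1-c_1)\min_{i\in[m]\setminus\mathcal{L}}\left\{\frac{\mu_i}{\tau L_i}\right\}}\;\|x^k-x^*\|,$$ where $c_1$ is a positive constant proportional to $\alpha_{\min}$, i.e. $c_1=C\alpha_{\min}$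 with a constant $C>0$ that does not depend on $\alpha_{\min}$.
   Context: Notation: $[m]=\{1,\dots,m\}$. For a problem $\min_{x\in\mathcal{X}}h(x)$ with vector-valued $h$, $x^*\in\mathcal{X}$ is a weakly Pareto solution if there is no $x\in\mathcal{X}$ with $h_i(x)<h_i(x^* )$ for all components $i$. A differentiable $h$ is $L$-smooth if $\|\nabla h(y)-\nabla h(x)\|\le L\|y-x\|$ for all $x,y$, and $\mu$-strongly convex if $\langle\nabla h(y)-\nabla h(x),y-x\rangle\ge\mu\|y-x\|^2$ for all $x,y$. ABBPGMO for (LCMOP) (the composite problem with $F_i=f_i+g_i$, $g_i$ the indicator function of $\mathcal{X}$, equal to $0$ on $\mathcal{X}$ and $+\infty$ outside). Given $x^0\in\mathcal{X}$, choose $x^{-1}\ne x^0$ in a small neighborhood of $x^0$. For $\alpha\in\mathbb{R}^m$ with positive entries, let $P_\alpha(x^k)$ be the unique minimizer over $x\in\mathcal{X}$ of $\max_{i\in[m]}\left\{\frac{\langle\nabla f_i(x^k),x-x^k\rangle}{\alpha_i}+\frac12\|x-x^k\|^2\right\}$. For $k=0,1,2,\dots$: 1. With $s^{k-1}=x^k-x^{k-1}$ and $y_i^{k-1}=\nabla f_i(x^k)-\nabla f_i(x^{k-1})$, initialize for each $i\in[m]$: $\alpha_i^k=\max\{\alpha_{\min},\min\{\langle s^{k-1},y_i^{k-1}\rangle/\langle s^{k-1},s^{k-1}\rangle,\alpha_{\max}\}\}$ if $\langle s^{k-1},y_i^{k-1}\rangle>0$; $\alpha_i^k=\max\{\alpha_{\min},\min\{\|y_i^{k-1}\|/\|s^{k-1}\|,\alpha_{\max}\}\}$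 if $\langle s^{k-1},y_i^{k-1}\rangle<0$; $\alpha_i^k=\alpha_{\min}$ if $\langle s^{k-1},y_i^{k-1}\rangle=0$. 2. Set $x^{k+1}=P_{\alpha^k}(x^k)$; stop if $x^{k+1}=x^k$. 3. Repeat: for every $i$ with $f_i(x^{k+1})-f_i(x^k)>\langle\nabla f_i(x^k),x^{k+1}-x^k\rangle+\frac{\alpha_i^k}{2}\|x^{k+1}-x^k\|^2$ replace $\alpha_i^k$ by $\tau\alpha_i^k$; then recompute $x^{k+1}=P_{\alpha^k}(x^k)$; until $f_i(x^{k+1})-f_i(x^k)\le\langle\nabla f_i(x^k),x^{k+1}-x^k\rangle+\frac{\alpha_i^k}{2}\|x^{k+1}-x^k\|^2$ for all $i\in[m]$. Standing assumption: the algorithm does not stop, i.e. it produces an infinite sequence of points that are not Pareto critical. *)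

theory Defs
  imports "HOL-Analysis.Analysis"
begin

definition gradient :: "('a::real_inner \<Rightarrow> real) \<Rightarrow> 'a \<Rightarrow> 'a" where
  "gradient h x = (THE D. GDERIV h x :> D)"

definition L_smooth :: "real \<Rightarrow> ('a::real_inner \<Rightarrow> real) \<Rightarrow> bool" where
  "L_smooth L h \<longleftrightarrow> (\<forall>x. h differentiable (at x)) \<and>
     (\<forall>x y. norm (gradient h y - gradient h x) \<le> L * norm (y - x))"

definition strongly_convex :: "real \<Rightarrow> ('a::real_inner \<Rightarrow> real) \<Rightarrow> bool" where
  "strongly_convex \<mu> h \<longleftrightarrow> (\<forall>x. h differentiable (at x)) \<and>
     (\<forall>x y. (gradient h y - gradient h x) \<bullet> (y - x) \<ge> \<mu> * (norm (y - x))\<^sup>2)"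

text \<open>The vector \<open>a\<close> bounds \<open>A *v x\<close> componentwise. Zero rows of \<open>A\<close> or \<open>B\<close> impose no constraint,
  so having at least one row of each kind is no restriction.\<close>

definition polyhedral_set :: "real^'n^'p \<Rightarrow> real^'p \<Rightarrow> real^'n^'q \<Rightarrow> real^'q \<Rightarrow> (real^'n) set" where
  "polyhedral_set A a B b = {x. A *v x \<le> a \<and> B *v x = b}"

text \<open>Weakly Pareto solutions over \<open>X\<close> of the vector-valued objective with components \<open>f i\<close>, \<open>i \<in> I\<close>.\<close>

definition weakly_pareto :: "'a set \<Rightarrow> 'i set \<Rightarrow> ('i \<Rightarrow> 'a \<Rightarrow> real) \<Rightarrow> 'a \<Rightarrow> bool" where
  "weakly_pareto X I f xs \<longleftrightarrow> xs \<in> X \<and> \<not> (\<exists>x\<in>X. \<forall>i\<in>I. f i x < f i xs)"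

text \<open>Pareto criticality of \<open>F\<^sub>i = f\<^sub>i +\<close> (indicator of \<open>X\<close>): some directional derivative
  \<open>F\<^sub>i'(x; d)\<close> is nonnegative for every \<open>d\<close>. For convex \<open>X\<close>, the derivatives are \<open>+\<infinity>\<close> unless
  \<open>d\<close> is a positive multiple of some \<open>y - x\<close> with \<open>y \<in> X\<close>.\<close>

definition pareto_critical ::
    "'a::real_inner set \<Rightarrow> ('i \<Rightarrow> 'a \<Rightarrow> real) \<Rightarrow> 'a \<Rightarrow> bool" where
  "pareto_critical X f x \<longleftrightarrow> x \<in> X \<and> (\<forall>y\<in>X. \<exists>i. gradient (f i) x \<bullet> (y - x) \<ge> 0)"

text \<open>The minimizer \<open>P\<^sub>\<alpha>(x)\<close>; it is unique when \<open>X\<close> is closed, convex and nonempty.\<close>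

definition bb_prox ::
    "'a::real_inner set \<Rightarrow> ('m::finite \<Rightarrow> 'a \<Rightarrow> real) \<Rightarrow> ('m \<Rightarrow> real) \<Rightarrow> 'a \<Rightarrow> 'a" where
  "bb_prox X f \<alpha> x =
     arg_min_on (\<lambda>y. MAX i. gradient (f i) x \<bullet> (y - x) / \<alpha> i + (norm (y - x))\<^sup>2 / 2) X"

definition bb_coeff :: "real \<Rightarrow> real \<Rightarrow> 'a::real_inner \<Rightarrow> 'a \<Rightarrow> real" where
  "bb_coeff \<alpha>min \<alpha>max s y =
     (if s \<bullet> y > 0 then max \<alpha>min (min ((s \<bullet> y) / (s \<bullet> s)) \<alpha>max)
      else if s \<bullet> y < 0 then max \<alpha>min (min (norm y / norm s) \<alpha>max)
      else \<alpha>min)"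

definition sufficient_decrease ::
    "('i \<Rightarrow> 'a::real_inner \<Rightarrow> real) \<Rightarrow> ('i \<Rightarrow> real) \<Rightarrow> 'a \<Rightarrow> 'a \<Rightarrow> 'i \<Rightarrow> bool" where
  "sufficient_decrease f \<alpha> x y i \<longleftrightarrow>
     f i y - f i x \<le> gradient (f i) x \<bullet> (y - x) + \<alpha> i / 2 * (norm (y - x))\<^sup>2"

text \<open>One pass of the backtracking loop at \<open>x\<close>: the coefficients violating the descent test at the
  current trial point are multiplied by \<open>\<tau>\<close>.\<close>

definition backtrack ::
    "'a::real_inner set \<Rightarrow> ('m::finite \<Rightarrow> 'a \<Rightarrow> real) \<Rightarrow> real \<Rightarrow> 'a \<Rightarrow> ('m \<Rightarrow> real) \<Rightarrow> ('m \<Rightarrow> real)" where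
  "backtrack X f \<tau> x \<alpha> =
     (\<lambda>i. if sufficient_decrease f \<alpha> x (bb_prox X f \<alpha> x) i then \<alpha> i else \<tau> * \<alpha> i)"

text \<open>\<open>abbpgmo_step X f \<tau> \<alpha>min \<alpha>max xprev x xnext\<close>: from the two most recent iterates the method
  does not stop at \<open>x\<close> and, after finitely many backtracking passes, moves to \<open>xnext\<close>. Here \<open>j\<close> is the
  number of passes that change some coefficient.\<close>

definition abbpgmo_step ::
    "'a::real_inner set \<Rightarrow> ('m::finite \<Rightarrow> 'a \<Rightarrow> real) \<Rightarrow> real \<Rightarrow> real \<Rightarrow> real \<Rightarrow> 'a \<Rightarrow> 'a \<Rightarrow> 'a \<Rightarrow> bool" where
  "abbpgmo_step X f \<tau> \<alpha>min \<alpha>max xprev x xnext \<longleftrightarrow>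
     (let \<alpha>0 = (\<lambda>i. bb_coeff \<alpha>min \<alpha>max (x - xprev) (gradient (f i) x - gradient (f i) xprev));
          \<alpha> = (\<lambda>j. (backtrack X f \<tau> x ^^ j) \<alpha>0);
          accepted = (\<lambda>j. \<forall>i. sufficient_decrease f (\<alpha> j) x (bb_prox X f (\<alpha> j) x) i)
      in bb_prox X f \<alpha>0 x \<noteq> x \<and>
         (\<exists>j. accepted j \<and> (\<forall>j'<j. \<not> accepted j') \<and> xnext = bb_prox X f (\<alpha> j) x))"

text \<open>\<open>x\<close> is an infinite sequence generated from \<open>x0\<close>, with \<open>xm1\<close> in the role of \<open>x\<close> at index \<open>-1\<close>.\<close>

definition abbpgmo_sequence ::
    "'a::real_inner set \<Rightarrow> ('m::finite \<Rightarrow> 'a \<Rightarrow> real) \<Rightarrow> real \<Rightarrow> real \<Rightarrow> real \<Rightarrow> 'a \<Rightarrow> 'a \<Rightarrow>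
     (nat \<Rightarrow> 'a) \<Rightarrow> bool" where
  "abbpgmo_sequence X f \<tau> \<alpha>min \<alpha>max xm1 x0 x \<longleftrightarrow>
     x 0 = x0 \<and>
     (\<forall>k. abbpgmo_step X f \<tau> \<alpha>min \<alpha>max (case k of 0 \<Rightarrow> xm1 | Suc j \<Rightarrow> x j) (x k) (x (Suc k))) \<and>
     (\<forall>k. \<not> pareto_critical X f (x k))"

end

theory Submission
  imports Defs
begin

text \<open>Let \<open>x\<close> and \<open>z\<close> be consecutive iterates. Separation in the space of objective values gives multipliers
  \<open>l\<close> of the subproblem at \<open>x\<close>, and the descent test together with (strong) convexity turns its optimality
  condition into the following inequality, for every \<open>y\<close> in \<open>X\<close>:
  \<open>\<parallel>z - y\<parallel>\<^sup>2 \<le> (1 - (\<Sum>i\<in>-\<L>. l i * (\<mu> i / \<alpha> i))) * \<parallel>x - y\<parallel>\<^sup>2 - 2 * (\<Sum>i. l i / \<alpha> i * (f i z - f i y))\<close>.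
  The objectives decrease along the iterates and one of them is strongly convex, so the iterates are
  bounded, and by the inequality they converge to any of their cluster points. For the rate, note that
  \<open>\<mu> i / \<alpha> i \<ge> \<mu> i / (\<tau> * Lc i)\<close> for \<open>i \<notin> \<L>\<close>, so it remains to see that the multipliers of the
  linear objectives, whose coefficient is always \<open>\<alpha>min\<close>, sum to at most a multiple of \<open>\<alpha>min\<close>:
  tested against a feasible direction along which all linear objectives descend at rate one, the
  optimality condition bounds their sum divided by \<open>\<alpha>min\<close>.\<close>

subsection \<open>Gradients and quadratic bounds\<close>

lemma gradient_eqI:
  assumes "GDERIV h x :> D"
  shows "gradient h x = D"
  unfolding gradient_def
proof (rule the_equality[of "\<lambda>D. GDERIV h x :> D", OF assms])
  fix E assume "GDERIV h x :> E"
  with assms have "(\<lambda>v. v \<bullet> E) = (\<lambda>v. v \<bullet> D)"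
    unfolding gderiv_def by (rule has_derivative_unique[rotated])
  then have "(E - D) \<bullet> (E - D) = 0"
    by (metis inner_diff_right right_minus_eq)
  then show "E = D" by simp
qed

text \<open>The Riesz vector of the derivative \<open>h'\<close> is its adjoint evaluated at 1;
  uniqueness of derivatives then identifies it with the \<open>THE\<close> in
  \<open>gradient\<close>.\<close>

lemma GDERIV_gradient:
  fixes h :: "'a::euclidean_space \<Rightarrow> real"
  assumes "h differentiable (at x)"
  shows "GDERIV h x :> gradient h x"
proof -
  from assms obtain h' where h': "(h has_derivative h') (at x)"
    by (auto simp: differentiable_def)
  have "h' = (\<lambda>v. v \<bullet> adjoint h' 1)"
    using adjoint_works[OF has_derivative_linear[OF h'], of _ 1] by auto
  with h' have "GDERIV h x :> adjoint h' 1"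
    unfolding gderiv_def by simp
  then show ?thesis using gradient_eqI by metis
qed

lemma linear_eq_gradient:
  fixes h :: "'a::euclidean_space \<Rightarrow> real"
  assumes "linear h"
  shows "h v = gradient h x \<bullet> v"
proof -
  have *: "h = (\<lambda>v. v \<bullet> adjoint h 1)"
    using adjoint_works[OF assms, of _ 1] by auto
  have "(h has_derivative h) (at x)"
    using assms by (simp add: linear_imp_has_derivative)
  with * have "GDERIV h x :> adjoint h 1"
    unfolding gderiv_def by metis
  then show ?thesis using * by (metis gradient_eqI inner_commute)
qed

lemma gradient_linear_const:
  fixes h :: "'a::euclidean_space \<Rightarrow> real"
  assumes "linear h"
  shows "gradient h x = gradient h y"
proof -
  have "\<forall>v. gradient h x \<bullet> v = gradient h y \<bullet> v"
    using linear_eq_gradient[OF assms] by metis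
  then show ?thesis by (simp only: vector_eq_rdot)
qed

lemma has_real_derivative_along_line:
  fixes h :: "'a::euclidean_space \<Rightarrow> real"
  assumes "\<And>x. h differentiable (at x)"
  shows "((\<lambda>t. h (x + t *\<^sub>R v)) has_real_derivative gradient h (x + t *\<^sub>R v) \<bullet> v) (at t)"
proof -
  have "((\<lambda>t. x + t *\<^sub>R v) has_derivative (\<lambda>s. s *\<^sub>R v)) (at t)"
    by (auto intro!: derivative_eq_intros)
  moreover have "(h has_derivative (\<lambda>w. w \<bullet> gradient h (x + t *\<^sub>R v))) (at (x + t *\<^sub>R v))"
    using GDERIV_gradient[OF assms] unfolding gderiv_def .
  ultimately have "((\<lambda>t. h (x + t *\<^sub>R v)) has_derivative
      (\<lambda>s. (s *\<^sub>R v) \<bullet> gradient h (x + t *\<^sub>R v))) (at t)"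
    by (rule has_derivative_compose)
  then show ?thesis
    unfolding has_field_derivative_def by (simp add: inner_commute mult_commute_abs)
qed

text \<open>Along the segment from \<open>x\<close> to \<open>y\<close>, the difference
  \<open>\<phi>\<close> between \<open>h\<close> and its quadratic model has nonpositive derivative.
  The sign of \<open>c\<close> is left free so that the strongly convex lower bound follows by
  passing to \<open>- h\<close> and \<open>c = - \<mu>\<close>.\<close>

lemma quadratic_upper_bound:
  fixes h :: "'a::euclidean_space \<Rightarrow> real"
  assumes diff: "\<And>x. h differentiable (at x)"
    and grad: "\<And>x y. (gradient h y - gradient h x) \<bullet> (y - x) \<le> c * (norm (y - x))\<^sup>2"
  shows "h y \<le> h x + gradient h x \<bullet> (y - x) + c / 2 * (norm (y - x))\<^sup>2"
proof -
  define v where "v = y - x"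
  define \<phi> where "\<phi> = (\<lambda>t. h (x + t *\<^sub>R v) - t * (gradient h x \<bullet> v) - c / 2 * t\<^sup>2 * (norm v)\<^sup>2)"
  have "\<phi> 1 \<le> \<phi> 0"
  proof (rule DERIV_nonpos_imp_nonincreasing[of 0 1 \<phi>])
    fix t :: real assume "0 \<le> t" "t \<le> 1"
    have "(\<phi> has_real_derivative
        gradient h (x + t *\<^sub>R v) \<bullet> v - gradient h x \<bullet> v - c * t * (norm v)\<^sup>2) (at t)"
      unfolding \<phi>_def
      by (auto intro!: derivative_eq_intros has_real_derivative_along_line[OF diff])
    moreover have "gradient h (x + t *\<^sub>R v) \<bullet> v - gradient h x \<bullet> v - c * t * (norm v)\<^sup>2 \<le> 0"
    proof (cases "t = 0")
      case False
      \<comment> \<open>The hypothesis at \<open>x\<close> and \<open>x + t v\<close> only controls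
        \<open>t\<close> times the derivative, so one factor \<open>t\<close> is cancelled
        afterwards.\<close>
      have "t * (gradient h (x + t *\<^sub>R v) \<bullet> v - gradient h x \<bullet> v) \<le> t * (c * t * (norm v)\<^sup>2)"
        using grad[where x = x and y = "x + t *\<^sub>R v"]
        by (simp add: inner_diff_left power_mult_distrib algebra_simps power2_eq_square)
      then show ?thesis using False \<open>0 \<le> t\<close> by (simp add: mult_le_cancel_left)
    qed simp
    ultimately show "\<exists>D. (\<phi> has_real_derivative D) (at t) \<and> D \<le> 0" by blast
  qed simp
  then show ?thesis by (simp add: \<phi>_def v_def)
qed

lemma L_smooth_upper_bound:
  fixes h :: "'a::euclidean_space \<Rightarrow> real"
  assumes "L_smooth L h"
  shows "h y \<le> h x + gradient h x \<bullet> (y - x) + L / 2 * (norm (y - x))\<^sup>2"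
proof (rule quadratic_upper_bound)
  fix x y
  have "(gradient h y - gradient h x) \<bullet> (y - x) \<le> norm (gradient h y - gradient h x) * norm (y - x)"
    by (rule norm_cauchy_schwarz)
  also have "\<dots> \<le> L * norm (y - x) * norm (y - x)"
    using assms by (intro mult_right_mono) (auto simp: L_smooth_def)
  finally show "(gradient h y - gradient h x) \<bullet> (y - x) \<le> L * (norm (y - x))\<^sup>2"
    by (simp add: power2_eq_square mult.assoc)
qed (use assms in \<open>auto simp: L_smooth_def\<close>)

lemma gradient_uminus:
  fixes h :: "'a::euclidean_space \<Rightarrow> real"
  assumes "h differentiable (at x)"
  shows "gradient (\<lambda>y. - h y) x = - gradient h x"
  using GDERIV_gradient[OF assms] by (intro gradient_eqI GDERIV_minus)

lemma strongly_convex_lower_bound: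
  fixes h :: "'a::euclidean_space \<Rightarrow> real"
  assumes "strongly_convex \<mu> h"
  shows "h y \<ge> h x + gradient h x \<bullet> (y - x) + \<mu> / 2 * (norm (y - x))\<^sup>2"
proof -
  have diff: "\<And>x. h differentiable (at x)"
    using assms by (auto simp: strongly_convex_def)
  have "- h y \<le> - h x + gradient (\<lambda>y. - h y) x \<bullet> (y - x) + (- \<mu>) / 2 * (norm (y - x))\<^sup>2"
  proof (rule quadratic_upper_bound)
    fix x y
    have "\<mu> * (norm (y - x))\<^sup>2 \<le> (gradient h y - gradient h x) \<bullet> (y - x)"
      using assms by (auto simp: strongly_convex_def)
    then show "(gradient (\<lambda>y. - h y) y - gradient (\<lambda>y. - h y) x) \<bullet> (y - x) \<le> - \<mu> * (norm (y - x))\<^sup>2"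
      by (simp add: gradient_uminus[OF diff] inner_diff_left)
  qed (intro differentiable_minus diff)
  then show ?thesis by (simp add: gradient_uminus[OF diff])
qed

text \<open>\<open>q\<close> is the Barzilai-Borwein quotient. These bounds show that truncation to
  \<open>\<alpha>min\<close> and \<open>\<alpha>max\<close> leaves it unchanged, and also that the
  smoothness constants are positive.\<close>

lemma strongly_convex_smooth_inner_bounds:
  fixes x y :: "'a::euclidean_space"
  assumes "strongly_convex \<mu> h" and "L_smooth L h" and "x \<noteq> y"
  defines "q \<equiv> (y - x) \<bullet> (gradient h y - gradient h x) / ((y - x) \<bullet> (y - x))"
  shows "\<mu> \<le> q" and "q \<le> L"
proof -
  have pos: "0 < (y - x) \<bullet> (y - x)" using assms by simp
  have "\<mu> * ((y - x) \<bullet> (y - x)) \<le> (y - x) \<bullet> (gradient h y - gradient h x)"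
    using assms(1) unfolding strongly_convex_def by (metis inner_commute power2_norm_eq_inner)
  then show "\<mu> \<le> q" unfolding q_def using pos by (simp add: le_divide_eq)
  have "(y - x) \<bullet> (gradient h y - gradient h x) \<le> norm (y - x) * norm (gradient h y - gradient h x)"
    by (rule norm_cauchy_schwarz)
  also have "\<dots> \<le> norm (y - x) * (L * norm (y - x))"
    using assms(2) by (intro mult_left_mono) (auto simp: L_smooth_def)
  also have "\<dots> = L * ((y - x) \<bullet> (y - x))"
    by (simp add: dot_square_norm power2_eq_square)
  finally show "q \<le> L" unfolding q_def using pos by (simp add: divide_le_eq)
qed

text \<open>The radius depends only on \<open>h\<close>, \<open>x\<close> and \<open>\<mu>\<close>.
  Applied at the starting point, it confines the iterates to a ball that is the same for every
  \<open>\<alpha>min\<close>.\<close>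

lemma strongly_convex_sublevel_bounded:
  fixes h :: "'a::euclidean_space \<Rightarrow> real"
  assumes "strongly_convex \<mu> h" and "\<mu> > 0" and "h y \<le> h x"
  shows "norm (y - x) \<le> 2 * norm (gradient h x) / \<mu>"
proof (cases "y = x")
  case False
  have "\<mu> / 2 * (norm (y - x))\<^sup>2 \<le> - (gradient h x \<bullet> (y - x))"
    using strongly_convex_lower_bound[OF assms(1), of x y] assms(3) by linarith
  also have "\<dots> \<le> norm (gradient h x) * norm (y - x)"
    using Cauchy_Schwarz_ineq2[of "gradient h x" "y - x"] by linarith
  finally have "norm (y - x) * (\<mu> / 2 * norm (y - x)) \<le> norm (y - x) * norm (gradient h x)"
    by (simp add: power2_eq_square algebra_simps)
  then have "\<mu> / 2 * norm (y - x) \<le> norm (gradient h x)"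
    using False by (simp add: mult_le_cancel_left)
  then show ?thesis using assms(2) by (simp add: field_simps)
qed (use assms in simp)

subsection \<open>The subproblem and its multipliers\<close>

text \<open>The subproblem objective with the coefficients absorbed into the vectors:
  \<open>v i\<close> stands for the gradient divided by \<open>\<alpha> i\<close>, so
  convex-analytic arguments need not carry the scaling.\<close>

definition prox_model :: "('m::finite \<Rightarrow> 'a::real_inner) \<Rightarrow> 'a \<Rightarrow> 'a \<Rightarrow> real" where
  "prox_model v x y = (MAX i. v i \<bullet> (y - x) + (norm (y - x))\<^sup>2 / 2)"

lemma bb_prox_eq: "bb_prox X f \<alpha> x = arg_min_on (prox_model (\<lambda>i. gradient (f i) x /\<^sub>R \<alpha> i) x) X"
  by (simp only: bb_prox_def prox_model_def[abs_def] divide_inverse_commute inner_scaleR_left)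

lemma prox_model_ge: "v i \<bullet> (y - x) + (norm (y - x))\<^sup>2 / 2 \<le> prox_model v x y"
  unfolding prox_model_def by (rule Max_ge) auto

lemma prox_model_less_iff:
  "prox_model v x y < c \<longleftrightarrow> (\<forall>i. v i \<bullet> (y - x) + (norm (y - x))\<^sup>2 / 2 < c)"
  unfolding prox_model_def by (subst Max_less_iff) auto

lemma prox_model_self [simp]: "prox_model v x x = 0"
  by (simp add: prox_model_def)

lemma continuous_on_MAX:
  fixes g :: "'i \<Rightarrow> 'a::topological_space \<Rightarrow> 'b::linorder_topology"
  assumes "finite I" and "I \<noteq> {}" and "\<And>i. i \<in> I \<Longrightarrow> continuous_on S (g i)"
  shows "continuous_on S (\<lambda>x. MAX i\<in>I. g i x)"
  using assms
proof (induction rule: finite_ne_induct)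
  case (insert i I)
  then have "continuous_on S (\<lambda>x. max (g i x) (MAX i\<in>I. g i x))"
    by (intro continuous_on_max) auto
  with insert.hyps show ?case by simp
qed simp

text \<open>Farther than \<open>2 * norm w\<close> from \<open>x\<close>, the quadratic term
  outweighs the linear term of one component, so the model is at least 0, its value at
  \<open>x\<close>. A minimizer over the remaining compact set is therefore global.\<close>

lemma prox_model_attains_min:
  fixes v :: "'m::finite \<Rightarrow> 'a::euclidean_space"
  assumes "closed X" and "x \<in> X"
  shows "\<exists>z\<in>X. \<forall>y\<in>X. prox_model v x z \<le> prox_model v x y"
proof -
  define w where "w = v undefined"
  define S where "S = X \<inter> cball x (2 * norm w)"
  have "compact S" using assms by (auto simp: S_def closed_Int_compact)
  moreover have "x \<in> S" using assms by (simp add: S_def)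
  moreover have "continuous_on S (prox_model v x)"
    unfolding prox_model_def[abs_def] by (intro continuous_on_MAX continuous_intros) auto
  ultimately obtain z where z: "z \<in> S" "\<And>y. y \<in> S \<Longrightarrow> prox_model v x z \<le> prox_model v x y"
    using continuous_attains_inf[of S "prox_model v x"] by blast
  have "prox_model v x z \<le> prox_model v x y" if "y \<in> X" "y \<notin> S" for y
  proof -
    have "2 * norm w < norm (y - x)"
      using that by (auto simp: S_def dist_norm norm_minus_commute)
    then have "norm w * norm (y - x) \<le> norm (y - x) / 2 * norm (y - x)"
      by (intro mult_right_mono) auto
    then have "0 \<le> w \<bullet> (y - x) + (norm (y - x))\<^sup>2 / 2"
      using Cauchy_Schwarz_ineq2[of w "y - x"] by (simp add: power2_eq_square)
    also have "\<dots> \<le> prox_model v x y" unfolding w_def by (rule prox_model_ge)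
    finally show ?thesis using z(2)[OF \<open>x \<in> S\<close>] by simp
  qed
  with z show ?thesis by (auto simp: S_def)
qed

lemma bb_prox_minimizes:
  fixes X :: "'a::euclidean_space set" and f :: "'m::finite \<Rightarrow> 'a \<Rightarrow> real" and \<alpha> :: "'m \<Rightarrow> real"
  assumes "closed X" and "x \<in> X"
  defines "z \<equiv> bb_prox X f \<alpha> x" and "\<phi> \<equiv> prox_model (\<lambda>i. gradient (f i) x /\<^sub>R \<alpha> i) x"
  shows "z \<in> X" and "y \<in> X \<Longrightarrow> \<phi> z \<le> \<phi> y"
proof -
  obtain u where "u \<in> X" "\<And>y. y \<in> X \<Longrightarrow> \<phi> u \<le> \<phi> y"
    using prox_model_attains_min[OF assms(1,2)] unfolding \<phi>_def by blast
  then have "is_arg_min \<phi> (\<lambda>y. y \<in> X) u"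
    by (auto simp: is_arg_min_linorder)
  then have "is_arg_min \<phi> (\<lambda>y. y \<in> X) z"
    unfolding z_def bb_prox_eq \<phi>_def arg_min_on_def arg_min_def by (rule someI)
  then show "z \<in> X" and "y \<in> X \<Longrightarrow> \<phi> z \<le> \<phi> y"
    by (auto simp: is_arg_min_linorder)
qed

lemma small_quadratic:
  fixes e c :: real
  assumes "0 < e" and "0 \<le> c"
  obtains t where "0 < t" "t \<le> 1" "t * c < e"
proof
  \<comment> \<open>The witness is \<open>t = e / (c + e + 1)\<close>: the summand \<open>e\<close>
    gives \<open>t \<le> 1\<close>, and the 1 makes the quotient safe when
    \<open>c = 0\<close>.\<close>
  have "e * c < e * (c + e + 1)" using assms by (intro mult_strict_left_mono) auto
  then show "e / (c + e + 1) * c < e" using assms by (simp add: divide_less_eq)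
qed (use assms in auto)

text \<open>If the inequality failed for every index, a short move from \<open>z\<close> towards
  \<open>y\<close> would push all components below the maximum: the first-order gain
  \<open>t * e\<close> beats the term quadratic in \<open>t\<close>. The right-hand side is the
  slack of component \<open>i\<close>, zero exactly when it is active, so no active set has to be
  singled out.\<close>

lemma prox_model_minimizer_inequality:
  fixes v :: "'m::finite \<Rightarrow> 'a::euclidean_space"
  assumes X: "convex X" "z \<in> X" "y \<in> X"
    and min: "\<And>u. u \<in> X \<Longrightarrow> prox_model v x z \<le> prox_model v x u"
  shows "\<exists>i. (v i + (z - x)) \<bullet> (y - z) \<ge> (MAX i. v i \<bullet> (z - x)) - v i \<bullet> (z - x)"
proof (rule ccontr)
  define M where "M = (MAX i. v i \<bullet> (z - x))"
  define e where "e = (MIN i. M - v i \<bullet> (z - x) - (v i + (z - x)) \<bullet> (y - z))"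
  assume "\<nexists>i. (v i + (z - x)) \<bullet> (y - z) \<ge> (MAX i. v i \<bullet> (z - x)) - v i \<bullet> (z - x)"
  then have "0 < e"
    unfolding e_def M_def[symmetric] by (subst Min_gr_iff) (auto simp: not_le)
  then obtain t where t: "0 < t" "t \<le> 1" "t * ((norm (y - z))\<^sup>2 / 2) < e"
    by (rule small_quadratic[of _ "(norm (y - z))\<^sup>2 / 2"]) auto
  define u where "u = z + t *\<^sub>R (y - z)"
  have "u = (1 - t) *\<^sub>R z + t *\<^sub>R y" by (simp add: u_def algebra_simps)
  then have "u \<in> X" using X t by (simp add: convexD)
  have M_ge: "v i \<bullet> (z - x) \<le> M" for i unfolding M_def by (rule Max_ge) auto
  have "prox_model v x u < M + (norm (z - x))\<^sup>2 / 2"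
    unfolding prox_model_less_iff
  proof
    fix i
    have "e \<le> M - v i \<bullet> (z - x) - (v i + (z - x)) \<bullet> (y - z)"
      unfolding e_def by (rule Min_le) auto
    then have "t * ((v i + (z - x)) \<bullet> (y - z)) \<le> t * (M - v i \<bullet> (z - x)) - t * e"
      using t(1) by (simp add: right_diff_distrib[symmetric] mult_left_mono)
    also have "t * (M - v i \<bullet> (z - x)) \<le> 1 * (M - v i \<bullet> (z - x))"
      using t(2) M_ge[of i] by (intro mult_right_mono) auto
    finally have 1: "t * ((v i + (z - x)) \<bullet> (y - z)) \<le> M - v i \<bullet> (z - x) - t * e" by simp
    have "t * (t * ((norm (y - z))\<^sup>2 / 2)) < t * e" using t by (intro mult_strict_left_mono) auto
    moreover have "v i \<bullet> (u - x) + (norm (u - x))\<^sup>2 / 2 = v i \<bullet> (z - x) + (norm (z - x))\<^sup>2 / 2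
      + t * ((v i + (z - x)) \<bullet> (y - z)) + t * (t * ((norm (y - z))\<^sup>2 / 2))"
      unfolding u_def power2_norm_eq_inner
      by (simp add: inner_simps inner_commute algebra_simps field_simps)
    ultimately show "v i \<bullet> (u - x) + (norm (u - x))\<^sup>2 / 2 < M + (norm (z - x))\<^sup>2 / 2"
      using 1 by linarith
  qed
  moreover have "M \<in> range (\<lambda>i. v i \<bullet> (z - x))" unfolding M_def by (rule Max_in) auto
  then have "M + (norm (z - x))\<^sup>2 / 2 \<le> prox_model v x z"
    using prox_model_ge[of v _ z x] by auto
  ultimately show False using min[OF \<open>u \<in> X\<close>] by linarith
qed

text \<open>A theorem of the alternative. The vectors strictly above some \<open>r y\<close> form a
  convex set \<open>K\<close>, and the preceding inequality keeps 0 out of it. A hyperplane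
  separating \<open>K\<close> from 0 has a nonnegative normal because \<open>K\<close> is closed
  under increasing coordinates; normalizing it gives the multipliers.\<close>

lemma prox_model_multipliers:
  fixes v :: "'m::finite \<Rightarrow> 'a::euclidean_space"
  assumes X: "convex X" "z \<in> X"
    and min: "\<And>u. u \<in> X \<Longrightarrow> prox_model v x z \<le> prox_model v x u"
  obtains l :: "'m \<Rightarrow> real" where "\<And>i. 0 \<le> l i" and "sum l UNIV = 1"
    and "\<And>y. y \<in> X \<Longrightarrow> 0 \<le> ((\<Sum>i\<in>UNIV. l i *\<^sub>R v i) + (z - x)) \<bullet> (y - z)"
proof -
  define M where "M = (MAX i. v i \<bullet> (z - x))"
  define r where "r y i = (v i + (z - x)) \<bullet> (y - z) + (v i \<bullet> (z - x) - M)" for y i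
  define K :: "(real^'m) set" where "K = {w. \<exists>y\<in>X. \<forall>i. r y i < w $ i}"
  \<comment> \<open>\<open>r\<close> is affine in \<open>y\<close>; this is what makes
    \<open>K\<close> convex.\<close>
  have r_conv: "r (s *\<^sub>R y + t *\<^sub>R y') i = s * r y i + t * r y' i" if "s + t = 1" for s t y y' i
  proof -
    have s: "s = 1 - t" using that by simp
    show ?thesis unfolding r_def s by (simp add: inner_simps algebra_simps)
  qed
  have "convex K"
  proof (rule convexI)
    fix w w' s t assume w: "w \<in> K" "w' \<in> K" and st: "0 \<le> s" "0 \<le> t" "s + t = (1::real)"
    then obtain y y' where y: "y \<in> X" "y' \<in> X" "\<And>i. r y i < w $ i" "\<And>i. r y' i < w' $ i"
      by (auto simp: K_def)
    have "s *\<^sub>R y + t *\<^sub>R y' \<in> X" using X(1) y st by (intro convexD)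
    moreover have "s * r y i + t * r y' i < s * w $ i + t * w' $ i" for i
    proof (cases "s = 0")
      case False
      then have "s * r y i < s * w $ i" using st y by (intro mult_strict_left_mono) auto
      moreover have "t * r y' i \<le> t * w' $ i" using st y by (intro mult_left_mono) (auto intro: less_imp_le)
      ultimately show ?thesis by linarith
    qed (use st y in simp)
    ultimately show "s *\<^sub>R w + t *\<^sub>R w' \<in> K" 
      unfolding K_def by (auto simp: r_conv[OF st(3)] intro!: bexI[of _ "s *\<^sub>R y + t *\<^sub>R y'"])
  qed
  moreover have "0 \<notin> K"
  proof
    assume "0 \<in> K"
    then obtain y where "y \<in> X" "\<And>i. r y i < 0" by (auto simp: K_def)
    with prox_model_minimizer_inequality[OF X \<open>y \<in> X\<close> min] show False
      unfolding r_def M_def by (smt (verit))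
  qed
  ultimately obtain a where a: "a \<noteq> 0" "\<And>w. w \<in> K \<Longrightarrow> 0 \<le> a \<bullet> w"
    using separating_hyperplane_set_0[of K] by auto
  \<comment> \<open>\<open>K\<close> is defined by strict inequalities, so \<open>r y + c\<close> is
    reached only in the limit. The shift \<open>d\<close> is chosen such that it changes the sum by
    at most \<open>e\<close>.\<close>
  have a_r: "0 \<le> (\<Sum>i\<in>UNIV. a $ i * (r y i + c i))" if "y \<in> X" "\<And>i. 0 \<le> c i" for y c
  proof (rule field_le_epsilon)
    fix e :: real assume "0 < e"
    define d where "d = e / (1 + \<bar>\<Sum>i\<in>UNIV. a $ i\<bar>)"
    have "0 < d" using \<open>0 < e\<close> by (simp add: d_def)
    have "r y i < r y i + c i + d" for i using that(2)[of i] \<open>0 < d\<close> by linarith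
    then have "(\<chi> i. r y i + c i + d) \<in> K" using that(1) unfolding K_def by (auto intro!: bexI[of _ y])
    from a(2)[OF this] have "0 \<le> (\<Sum>i\<in>UNIV. a $ i * (r y i + c i + d))"
      by (simp add: inner_vec_def)
    also have "\<dots> = (\<Sum>i\<in>UNIV. a $ i * (r y i + c i)) + d * (\<Sum>i\<in>UNIV. a $ i)"
      by (simp add: algebra_simps sum.distrib sum_distrib_left)
    also have "d * (\<Sum>i\<in>UNIV. a $ i) \<le> d * (1 + \<bar>\<Sum>i\<in>UNIV. a $ i\<bar>)"
      using \<open>0 < d\<close> by (intro mult_left_mono) auto
    also have "\<dots> = e" by (simp add: d_def)
    finally show "0 \<le> (\<Sum>i\<in>UNIV. a $ i * (r y i + c i)) + e" by simp
  qed
  have a_nonneg: "0 \<le> a $ j" for j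
  proof (rule ccontr)
    assume neg: "\<not> 0 \<le> a $ j"
    define s where "s = (\<Sum>i\<in>UNIV. a $ i * r z i)"
    \<comment> \<open>Raising coordinate \<open>j\<close> this far would turn the sum into
      \<open>s - (\<bar>s\<bar> + 1)\<close>, which is negative.\<close>
    define c where "c i = (if i = j then (\<bar>s\<bar> + 1) / - a $ j else 0)" for i
    have "0 \<le> c i" for i using neg by (simp add: c_def divide_nonneg_neg)
    from a_r[OF X(2) this] have "0 \<le> (\<Sum>i\<in>UNIV. a $ i * (r z i + c i))" .
    also have "\<dots> = s + (\<Sum>i\<in>UNIV. a $ i * c i)"
      by (simp add: s_def distrib_left sum.distrib)
    also have "(\<Sum>i\<in>UNIV. a $ i * c i) = a $ j * ((\<bar>s\<bar> + 1) / - a $ j)"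
      by (simp add: c_def if_distrib cong: if_cong)
    also have "\<dots> = - (\<bar>s\<bar> + 1)" using neg by simp
    finally show False by linarith
  qed
  define \<sigma> where "\<sigma> = (\<Sum>i\<in>UNIV. a $ i)"
  have "\<sigma> \<noteq> 0"
    using a(1) a_nonneg unfolding \<sigma>_def by (simp add: sum_nonneg_eq_0_iff vec_eq_iff)
  then have "0 < \<sigma>" using a_nonneg by (simp add: \<sigma>_def order_less_le sum_nonneg)
  define l where "l i = a $ i / \<sigma>" for i
  have l_nonneg: "0 \<le> l i" for i using a_nonneg \<open>0 < \<sigma>\<close> by (simp add: l_def)
  moreover have l_sum: "sum l UNIV = 1"
    using \<open>\<sigma> \<noteq> 0\<close> by (simp add: l_def[abs_def] sum_divide_distrib[symmetric] \<sigma>_def[symmetric])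
  moreover have "0 \<le> ((\<Sum>i\<in>UNIV. l i *\<^sub>R v i) + (z - x)) \<bullet> (y - z)" if "y \<in> X" for y
  proof -
    have "0 \<le> (\<Sum>i\<in>UNIV. a $ i * r y i) / \<sigma>" using a_r[OF that, of "\<lambda>_. 0"] \<open>0 < \<sigma>\<close> by simp
    also have "\<dots> = (\<Sum>i\<in>UNIV. l i * r y i)" by (simp add: l_def sum_divide_distrib)
    also have "\<dots> \<le> (\<Sum>i\<in>UNIV. l i * ((v i + (z - x)) \<bullet> (y - z)))"
    \<comment> \<open>The slack part of \<open>r\<close> is nonpositive, so dropping it only
      enlarges the sum.\<close>
    proof (intro sum_mono mult_left_mono l_nonneg)
      fix i
      have "v i \<bullet> (z - x) \<le> M" unfolding M_def by (rule Max_ge) auto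
      then show "r y i \<le> (v i + (z - x)) \<bullet> (y - z)" by (simp add: r_def)
    qed
    also have "\<dots> = ((\<Sum>i\<in>UNIV. l i *\<^sub>R v i) + sum l UNIV *\<^sub>R (z - x)) \<bullet> (y - z)"
      by (simp add: inner_add_left inner_sum_left distrib_left sum.distrib sum_distrib_right)
    finally show ?thesis by (simp add: l_sum)
  qed
  ultimately show thesis by (rule that)
qed

text \<open>At \<open>z = x\<close> all components are active and the slack vanishes. The result
  rules out a repeated iterate even when later backtracking passes have changed the trial
  point.\<close>

lemma bb_prox_fixed_point_critical:
  fixes X :: "'a::euclidean_space set" and f :: "'m::finite \<Rightarrow> 'a \<Rightarrow> real" and \<alpha> :: "'m \<Rightarrow> real"
  assumes X: "closed X" "convex X" "x \<in> X" and pos: "\<And>i. 0 < \<alpha> i" and fixed: "bb_prox X f \<alpha> x = x"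
  shows "pareto_critical X f x"
  unfolding pareto_critical_def
proof (intro conjI ballI X(3))
  fix y assume "y \<in> X"
  define v where "v = (\<lambda>i. gradient (f i) x /\<^sub>R \<alpha> i)"
  have "prox_model v x x \<le> prox_model v x u" if "u \<in> X" for u
    using bb_prox_minimizes(2)[OF X(1,3) that, where f = f and \<alpha> = \<alpha>] unfolding fixed v_def .
  then obtain i where "0 \<le> v i \<bullet> (y - x)"
    using prox_model_minimizer_inequality[OF X(2,3) \<open>y \<in> X\<close>, of v x]
    by (auto simp: image_constant_conv)
  then show "\<exists>i. 0 \<le> gradient (f i) x \<bullet> (y - x)"
    using pos[of i] by (auto simp: v_def zero_le_mult_iff)
qed

subsection \<open>One step of the method\<close>

lemma sum_UNIV_split:
  fixes g :: "'i::finite \<Rightarrow> 'b::comm_monoid_add"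
  shows "sum g UNIV = sum g S + sum g (- S)"
  using sum.subset_diff[of S UNIV g] by (simp add: Compl_eq_Diff_UNIV add.commute)

text \<open>Convergence uses only that \<open>X\<close> is closed and convex; polyhedrality enters
  later, for the descent directions behind the rate. Since \<open>\<alpha>min\<close> is a parameter
  here, the constant of the rate has to be fixed before the locale is interpreted.\<close>

locale partly_linear_problem =
  fixes X :: "'a::euclidean_space set" and f :: "'m::finite \<Rightarrow> 'a \<Rightarrow> real"
    and \<L> :: "'m set" and \<mu> Lc :: "'m \<Rightarrow> real" and \<tau> \<alpha>min \<alpha>max :: real
  assumes closed_X: "closed X" and convex_X: "convex X"
    and linear_f: "i \<in> \<L> \<Longrightarrow> linear (f i)"
    and \<mu>_pos: "i \<notin> \<L> \<Longrightarrow> 0 < \<mu> i"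
    and strongly_convex_f: "i \<notin> \<L> \<Longrightarrow> strongly_convex (\<mu> i) (f i)"
    and L_smooth_f: "i \<notin> \<L> \<Longrightarrow> L_smooth (Lc i) (f i)"
    and \<tau>_gt_1: "1 < \<tau>"
    and \<alpha>min_pos: "0 < \<alpha>min"
    and \<alpha>min_le: "i \<notin> \<L> \<Longrightarrow> \<alpha>min \<le> \<mu> i"
    and \<alpha>max_ge: "i \<notin> \<L> \<Longrightarrow> Lc i \<le> \<alpha>max"
begin

lemma f_lower_bound:
  "f i x + gradient (f i) x \<bullet> (y - x) + (if i \<in> \<L> then 0 else \<mu> i) / 2 * (norm (y - x))\<^sup>2 \<le> f i y"
proof (cases "i \<in> \<L>")
  case True
  then show ?thesis
    using linear_eq_gradient[OF linear_f[OF True], of _ x] by (simp add: inner_diff_right)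
qed (use strongly_convex_lower_bound[OF strongly_convex_f] in auto)

lemma f_differentiable: "f i differentiable (at x)"
  using strongly_convex_f[of i] linear_f[of i]
  by (cases "i \<in> \<L>") (auto simp: strongly_convex_def linear_imp_differentiable)

lemma isCont_f: "isCont (f i) x"
  by (rule differentiable_imp_continuous_within[OF f_differentiable])

text \<open>The range that initialization and backtracking preserve. The factor
  \<open>\<tau>\<close> allows for the one increase that may carry a coefficient beyond
  \<open>Lc i\<close>.\<close>

definition admissible :: "('m \<Rightarrow> real) \<Rightarrow> bool" where
  "admissible \<alpha> \<longleftrightarrow> (\<forall>i\<in>\<L>. \<alpha> i = \<alpha>min) \<and> (\<forall>i. i \<notin> \<L> \<longrightarrow> \<mu> i \<le> \<alpha> i \<and> \<alpha> i \<le> \<tau> * Lc i)"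

lemma admissible_pos: "admissible \<alpha> \<Longrightarrow> 0 < \<alpha> i"
  using \<mu>_pos[of i] \<alpha>min_pos by (cases "i \<in> \<L>") (force simp: admissible_def)+

text \<open>A linear objective has constant gradient, hence zero inner product and the default
  \<open>\<alpha>min\<close>. For the others the quotient is positive and lies between
  \<open>\<mu> i\<close> and \<open>Lc i\<close>, hence between \<open>\<alpha>min\<close> and
  \<open>\<alpha>max\<close>.\<close>

lemma admissible_bb_coeff:
  assumes "p \<noteq> x"
  shows "admissible (\<lambda>i. bb_coeff \<alpha>min \<alpha>max (x - p) (gradient (f i) x - gradient (f i) p))"
  unfolding admissible_def
proof (intro conjI ballI allI impI)
  fix i assume "i \<in> \<L>"
  then show "bb_coeff \<alpha>min \<alpha>max (x - p) (gradient (f i) x - gradient (f i) p) = \<alpha>min"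
    using gradient_linear_const[OF linear_f, of i x p] by (simp add: bb_coeff_def)
next
  fix i assume i: "i \<notin> \<L>"
  define q where "q = (x - p) \<bullet> (gradient (f i) x - gradient (f i) p) / ((x - p) \<bullet> (x - p))"
  have q: "\<mu> i \<le> q" "q \<le> Lc i"
    unfolding q_def
    using strongly_convex_smooth_inner_bounds[OF strongly_convex_f L_smooth_f] i assms by blast+
  then have "0 < q" using \<mu>_pos[OF i] by simp
  then have "0 < (x - p) \<bullet> (gradient (f i) x - gradient (f i) p)"
    unfolding q_def using inner_ge_zero[of "x - p"] by (auto simp: zero_less_divide_iff)
  then have eq: "bb_coeff \<alpha>min \<alpha>max (x - p) (gradient (f i) x - gradient (f i) p)
      = max \<alpha>min (min q \<alpha>max)"
    by (simp add: bb_coeff_def q_def)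
  have "1 * Lc i \<le> \<tau> * Lc i"
    using \<tau>_gt_1 q \<open>0 < q\<close> by (intro mult_right_mono) auto
  then show "\<mu> i \<le> bb_coeff \<alpha>min \<alpha>max (x - p) (gradient (f i) x - gradient (f i) p)"
    and "bb_coeff \<alpha>min \<alpha>max (x - p) (gradient (f i) x - gradient (f i) p) \<le> \<tau> * Lc i"
    unfolding eq using q \<alpha>min_le[OF i] \<alpha>max_ge[OF i] by auto
qed

text \<open>Linear objectives always pass the descent test. By smoothness a coefficient above
  \<open>Lc i\<close> passes too, so only coefficients up to \<open>Lc i\<close> are ever multiplied
  by \<open>\<tau>\<close>.\<close>

lemma admissible_backtrack:
  assumes "admissible \<alpha>"
  shows "admissible (backtrack X f \<tau> x \<alpha>)"
  unfolding admissible_def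
proof (intro conjI ballI allI impI)
  fix i assume i: "i \<in> \<L>"
  have "f i z - f i x \<le> gradient (f i) x \<bullet> (z - x) + \<alpha> i / 2 * (norm (z - x))\<^sup>2" for z
    using linear_eq_gradient[OF linear_f[OF i], of _ x] admissible_pos[OF assms, of i]
    by (simp add: inner_diff_right)
  then show "backtrack X f \<tau> x \<alpha> i = \<alpha>min"
    using assms i by (simp add: backtrack_def sufficient_decrease_def admissible_def)
next
  fix i assume i: "i \<notin> \<L>"
  have pos: "0 < \<alpha> i" using assms by (rule admissible_pos)
  have "\<alpha> i \<le> Lc i" if "\<not> sufficient_decrease f \<alpha> x z i" for z
  proof (rule ccontr)
    assume "\<not> \<alpha> i \<le> Lc i"
    then have "Lc i / 2 * (norm (z - x))\<^sup>2 \<le> \<alpha> i / 2 * (norm (z - x))\<^sup>2"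
      by (intro mult_right_mono) auto
    with L_smooth_upper_bound[OF L_smooth_f[OF i], of z x] that show False
      by (simp add: sufficient_decrease_def)
  qed
  moreover have "\<alpha> i \<le> \<tau> * \<alpha> i" using \<tau>_gt_1 pos by simp
  ultimately show "\<mu> i \<le> backtrack X f \<tau> x \<alpha> i" and "backtrack X f \<tau> x \<alpha> i \<le> \<tau> * Lc i"
    using assms i \<tau>_gt_1 by (auto simp: backtrack_def admissible_def intro: order_trans mult_left_mono)
qed

text \<open>All that the later estimates use of an accepted step. The weights are
  \<open>l i / \<alpha> i\<close> because the multipliers belong to the scaled gradients.\<close>

definition multiplier_step :: "'a \<Rightarrow> 'a \<Rightarrow> ('m \<Rightarrow> real) \<Rightarrow> ('m \<Rightarrow> real) \<Rightarrow> bool" where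
  "multiplier_step x z \<alpha> l \<longleftrightarrow> z \<in> X \<and> admissible \<alpha> \<and> (\<forall>i. sufficient_decrease f \<alpha> x z i) \<and>
     (\<forall>i. 0 \<le> l i) \<and> sum l UNIV = 1 \<and>
     (\<forall>y\<in>X. 0 \<le> ((\<Sum>i\<in>UNIV. (l i / \<alpha> i) *\<^sub>R gradient (f i) x) + (z - x)) \<bullet> (y - z))"

text \<open>The third conclusion feeds the next step: the Barzilai-Borwein quotient there needs two
  distinct points.\<close>

lemma abbpgmo_step_multipliers:
  assumes step: "abbpgmo_step X f \<tau> \<alpha>min \<alpha>max p x z" and x: "x \<in> X" and p: "p \<noteq> x"
  shows "\<exists>\<alpha> l. multiplier_step x z \<alpha> l"
    and "f i z \<le> f i x"
    and "\<not> pareto_critical X f x \<Longrightarrow> z \<noteq> x"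
proof -
  define \<beta> where "\<beta> j = (backtrack X f \<tau> x ^^ j)
      (\<lambda>i. bb_coeff \<alpha>min \<alpha>max (x - p) (gradient (f i) x - gradient (f i) p))" for j
  obtain j where j: "\<forall>i. sufficient_decrease f (\<beta> j) x (bb_prox X f (\<beta> j) x) i"
      "z = bb_prox X f (\<beta> j) x"
    using step unfolding abbpgmo_step_def Let_def \<beta>_def by (elim conjE exE)
  define \<alpha> where "\<alpha> = \<beta> j"
  have z: "z = bb_prox X f \<alpha> x" and acc: "\<And>i. sufficient_decrease f \<alpha> x z i"
    using j by (simp_all add: \<alpha>_def)
  have adm: "admissible \<alpha>"
    unfolding \<alpha>_def \<beta>_def
    by (induction j) (auto intro: admissible_bb_coeff[OF p] admissible_backtrack)
  show "z \<noteq> x" if "\<not> pareto_critical X f x"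
    using bb_prox_fixed_point_critical[OF closed_X convex_X x admissible_pos[OF adm], where f = f] z that by auto
  define v where "v = (\<lambda>i. gradient (f i) x /\<^sub>R \<alpha> i)"
  have zX: "z \<in> X" and min: "\<And>u. u \<in> X \<Longrightarrow> prox_model v x z \<le> prox_model v x u"
    unfolding z v_def by (rule bb_prox_minimizes[OF closed_X x])+
  show "f i z \<le> f i x"
  proof -
    \<comment> \<open>The model is 0 at \<open>x\<close>, hence nonpositive at the minimizer
      \<open>z\<close>. Multiplied by \<open>\<alpha> i\<close>, each component becomes the
      right-hand side of the descent test.\<close>
    have "v i \<bullet> (z - x) + (norm (z - x))\<^sup>2 / 2 \<le> 0"
      using prox_model_ge[of v i z x] min[OF x] by simp
    then have "\<alpha> i * (v i \<bullet> (z - x) + (norm (z - x))\<^sup>2 / 2) \<le> 0"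
      using admissible_pos[OF adm, of i] by (simp add: mult_le_0_iff)
    then have "gradient (f i) x \<bullet> (z - x) + \<alpha> i / 2 * (norm (z - x))\<^sup>2 \<le> 0"
      using admissible_pos[OF adm, of i] by (simp add: v_def distrib_left mult.assoc[symmetric])
    with acc[of i] show ?thesis by (simp add: sufficient_decrease_def)
  qed
  obtain l where "\<And>i. 0 \<le> l i" "sum l UNIV = 1"
    and "\<And>y. y \<in> X \<Longrightarrow> 0 \<le> ((\<Sum>i\<in>UNIV. l i *\<^sub>R v i) + (z - x)) \<bullet> (y - z)"
    using prox_model_multipliers[OF convex_X zX min] by blast
  moreover have "(l i / \<alpha> i) *\<^sub>R gradient (f i) x = l i *\<^sub>R v i" for i
    by (simp only: v_def scaleR_scaleR divide_inverse)
  ultimately show "\<exists>\<alpha> l. multiplier_step x z \<alpha> l"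
    using acc adm zX unfolding multiplier_step_def by (intro exI[of _ \<alpha>] exI[of _ l]) auto
qed

text \<open>The descent test bounds \<open>f i z - f i x\<close> from above and convexity bounds
  \<open>f i y - f i x\<close> from below. With weights \<open>l i / \<alpha> i\<close> the
  coefficient cancels in the term with \<open>norm (z - x)\<close>, whose total weight is then 1;
  optimality of \<open>z\<close> handles the gradient term.\<close>

lemma multiplier_step_fejer:
  assumes "multiplier_step x z \<alpha> l" and y: "y \<in> X"
  shows "(norm (z - y))\<^sup>2 \<le> (1 - (\<Sum>i\<in>- \<L>. l i * (\<mu> i / \<alpha> i))) * (norm (x - y))\<^sup>2
    - 2 * (\<Sum>i\<in>UNIV. l i / \<alpha> i * (f i z - f i y))"
proof -
  from assms(1) have adm: "admissible \<alpha>" and dec: "\<And>i. sufficient_decrease f \<alpha> x z i"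
    and l: "\<And>i. 0 \<le> l i" "sum l UNIV = 1"
    and vi: "0 \<le> ((\<Sum>i\<in>UNIV. (l i / \<alpha> i) *\<^sub>R gradient (f i) x) + (z - x)) \<bullet> (y - z)"
    using y by (auto simp: multiplier_step_def)
  define \<mu>' where "\<mu>' i = (if i \<in> \<L> then 0 else \<mu> i)" for i
  define G where "G = (\<Sum>i\<in>UNIV. (l i / \<alpha> i) *\<^sub>R gradient (f i) x)"
  have S: "(\<Sum>i\<in>UNIV. l i * (\<mu>' i / \<alpha> i)) = (\<Sum>i\<in>- \<L>. l i * (\<mu> i / \<alpha> i))"
    by (rule sum.mono_neutral_cong_right) (auto simp: \<mu>'_def)
  have "(\<Sum>i\<in>UNIV. l i / \<alpha> i * (f i z - f i y)) \<le> (\<Sum>i\<in>UNIV. l i / \<alpha> i *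
      (gradient (f i) x \<bullet> (z - y) + \<alpha> i / 2 * (norm (z - x))\<^sup>2 - \<mu>' i / 2 * (norm (y - x))\<^sup>2))"
  proof (intro sum_mono mult_left_mono)
    fix i
    show "f i z - f i y \<le> gradient (f i) x \<bullet> (z - y) + \<alpha> i / 2 * (norm (z - x))\<^sup>2 - \<mu>' i / 2 * (norm (y - x))\<^sup>2"
      using dec[of i] f_lower_bound[of i x y, folded \<mu>'_def]
      by (simp add: sufficient_decrease_def inner_diff_right)
    show "0 \<le> l i / \<alpha> i" using l(1)[of i] admissible_pos[OF adm, of i] by simp
  qed
  also have "\<dots> = (\<Sum>i\<in>UNIV. (l i / \<alpha> i) * (gradient (f i) x \<bullet> (z - y)) + l i * ((norm (z - x))\<^sup>2 / 2)
      - l i * (\<mu>' i / \<alpha> i) * ((norm (y - x))\<^sup>2 / 2))"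
    using admissible_pos[OF adm] by (intro sum.cong refl) (simp add: field_simps less_imp_neq[symmetric])
  also have "\<dots> = G \<bullet> (z - y) + sum l UNIV * ((norm (z - x))\<^sup>2 / 2)
      - (\<Sum>i\<in>UNIV. l i * (\<mu>' i / \<alpha> i)) * ((norm (y - x))\<^sup>2 / 2)"
    by (simp only: G_def sum.distrib sum_subtractf inner_sum_left inner_scaleR_left sum_distrib_right)
  finally have main: "2 * (\<Sum>i\<in>UNIV. l i / \<alpha> i * (f i z - f i y)) \<le> 2 * (G \<bullet> (z - y)) + (norm (z - x))\<^sup>2
      - (\<Sum>i\<in>- \<L>. l i * (\<mu> i / \<alpha> i)) * (norm (x - y))\<^sup>2"
    unfolding S l(2) norm_minus_commute[of y x] by simp
  have "G \<bullet> (z - y) \<le> (z - x) \<bullet> (y - z)"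
    using vi by (simp add: G_def[symmetric] inner_add_left inner_diff_right)
  \<comment> \<open>The three-point identity turns the remaining inner product into a difference of
    squared distances.\<close>
  moreover have "2 * ((z - x) \<bullet> (y - z)) + (norm (z - x))\<^sup>2 = (norm (x - y))\<^sup>2 - (norm (z - y))\<^sup>2"
    unfolding power2_norm_eq_inner by (simp add: inner_simps inner_commute algebra_simps)
  ultimately show ?thesis using main by (simp add: left_diff_distrib)
qed

text \<open>Used twice: with \<open>m = 0\<close> for monotone distances to a cluster point, and
  with the minimal ratio for the rate.\<close>

lemma multiplier_step_contraction:
  assumes step: "multiplier_step x z \<alpha> l" and y: "y \<in> X" and le: "\<And>i. f i y \<le> f i z"
    and m: "0 \<le> m" "\<And>i. i \<notin> \<L> \<Longrightarrow> m \<le> \<mu> i / \<alpha> i" and s: "sum l \<L> \<le> s"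
  shows "norm (z - y) \<le> sqrt (1 - (1 - s) * m) * norm (x - y)"
proof -
  have adm: "admissible \<alpha>" and l: "\<And>i. 0 \<le> l i" "sum l UNIV = 1"
    using step by (auto simp: multiplier_step_def)
  have "(norm (z - y))\<^sup>2 \<le> (1 - (\<Sum>i\<in>- \<L>. l i * (\<mu> i / \<alpha> i))) * (norm (x - y))\<^sup>2
      - 2 * (\<Sum>i\<in>UNIV. l i / \<alpha> i * (f i z - f i y))"
    by (rule multiplier_step_fejer[OF step y])
  also have "\<dots> \<le> (1 - (\<Sum>i\<in>- \<L>. l i * (\<mu> i / \<alpha> i))) * (norm (x - y))\<^sup>2"
    using le l(1) admissible_pos[OF adm] by (simp add: sum_nonneg less_imp_le)
  also have "\<dots> \<le> (1 - (1 - s) * m) * (norm (x - y))\<^sup>2"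
  proof (intro mult_right_mono diff_left_mono)
    have "sum l UNIV = sum l \<L> + sum l (- \<L>)"
      by (rule sum_UNIV_split)
    then have "(1 - s) * m \<le> sum l (- \<L>) * m"
      using l(2) s m(1) by (intro mult_right_mono) auto
    also have "\<dots> \<le> (\<Sum>i\<in>- \<L>. l i * (\<mu> i / \<alpha> i))"
      unfolding sum_distrib_right using l(1) m(2) by (intro sum_mono mult_left_mono) auto
    finally show "(1 - s) * m \<le> (\<Sum>i\<in>- \<L>. l i * (\<mu> i / \<alpha> i))" .
  qed simp
  finally have "sqrt ((norm (z - y))\<^sup>2) \<le> sqrt ((1 - (1 - s) * m) * (norm (x - y))\<^sup>2)"
    by (rule real_sqrt_le_mono)
  then show ?thesis by (simp add: real_sqrt_mult)
qed

text \<open>In the optimality condition tested with \<open>w\<close>, the linear objectives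
  contribute at most \<open>- sum l \<L> / \<alpha>min\<close>, while all other terms are bounded
  independently of \<open>\<alpha>min\<close> on the ball around \<open>c\<close>.\<close>

lemma sum_linear_multipliers_le:
  assumes step: "multiplier_step x z \<alpha> l"
    and w: "z + t *\<^sub>R w \<in> X" "0 < t" "norm w \<le> K" "\<And>i. i \<in> \<L> \<Longrightarrow> f i w \<le> - 1"
    and D: "norm (x - c) \<le> D" "norm (z - c) \<le> D"
    and Lc: "\<And>i. i \<notin> \<L> \<Longrightarrow> 0 \<le> Lc i"
  shows "sum l \<L> \<le> K * ((\<Sum>i\<in>- \<L>. (norm (gradient (f i) c) + Lc i * D) / \<mu> i) + 2 * D) * \<alpha>min"
proof -
  have adm: "admissible \<alpha>" and l: "\<And>i. 0 \<le> l i" "sum l UNIV = 1"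
    and vi: "0 \<le> ((\<Sum>i\<in>UNIV. (l i / \<alpha> i) *\<^sub>R gradient (f i) x) + (z - x)) \<bullet> (z + t *\<^sub>R w - z)"
    using step w(1) unfolding multiplier_step_def by blast+
  \<comment> \<open>The step length \<open>t\<close> cancels, so the bound does not depend on how
    far \<open>w\<close> can be followed inside \<open>X\<close>.\<close>
  have "0 \<le> ((\<Sum>i\<in>UNIV. (l i / \<alpha> i) *\<^sub>R gradient (f i) x) + (z - x)) \<bullet> w"
    using vi w(2) by (simp add: zero_le_mult_iff)
  also have "\<dots> = (\<Sum>i\<in>UNIV. l i / \<alpha> i * (gradient (f i) x \<bullet> w)) + (z - x) \<bullet> w"
    by (simp add: inner_add_left inner_sum_left)
  also have "(\<Sum>i\<in>UNIV. l i / \<alpha> i * (gradient (f i) x \<bullet> w))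
      = (\<Sum>i\<in>\<L>. l i / \<alpha> i * (gradient (f i) x \<bullet> w)) + (\<Sum>i\<in>- \<L>. l i / \<alpha> i * (gradient (f i) x \<bullet> w))"
    by (rule sum_UNIV_split)
  also have "(\<Sum>i\<in>\<L>. l i / \<alpha> i * (gradient (f i) x \<bullet> w)) \<le> (\<Sum>i\<in>\<L>. - (l i / \<alpha>min))"
  proof (rule sum_mono)
    fix i assume i: "i \<in> \<L>"
    have "l i / \<alpha>min * f i w \<le> l i / \<alpha>min * (- 1)"
      using w(4)[OF i] l(1) \<alpha>min_pos by (intro mult_left_mono) auto
    then show "l i / \<alpha> i * (gradient (f i) x \<bullet> w) \<le> - (l i / \<alpha>min)"
      using linear_eq_gradient[OF linear_f[OF i], of w x] adm i by (simp add: admissible_def)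
  qed
  also have "\<dots> = - (sum l \<L> / \<alpha>min)" by (simp add: sum_negf sum_divide_distrib)
  also have "(\<Sum>i\<in>- \<L>. l i / \<alpha> i * (gradient (f i) x \<bullet> w))
      \<le> (\<Sum>i\<in>- \<L>. (norm (gradient (f i) c) + Lc i * D) / \<mu> i * K)"
  proof (rule sum_mono)
    fix i assume "i \<in> - \<L>"
    then have i: "i \<notin> \<L>" by simp
    have "l i \<le> 1" using member_le_sum[of i UNIV l] l by auto
    have "norm (gradient (f i) x - gradient (f i) c) \<le> Lc i * norm (x - c)"
      using L_smooth_f[OF i] by (auto simp: L_smooth_def)
    also have "\<dots> \<le> Lc i * D" using Lc[OF i] D by (intro mult_left_mono)
    finally have "norm (gradient (f i) x) \<le> norm (gradient (f i) c) + Lc i * D"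
      using norm_triangle_ineq2[of "gradient (f i) x" "gradient (f i) c"] by linarith
    then have "norm (gradient (f i) x) * norm w \<le> (norm (gradient (f i) c) + Lc i * D) * K"
      using w(3) by (intro mult_mono) (auto intro: order_trans[OF norm_ge_zero])
    then have "gradient (f i) x \<bullet> w \<le> (norm (gradient (f i) c) + Lc i * D) * K"
      using norm_cauchy_schwarz order_trans by blast
    then have "l i / \<alpha> i * (gradient (f i) x \<bullet> w) \<le> l i / \<alpha> i * ((norm (gradient (f i) c) + Lc i * D) * K)"
      using l(1) admissible_pos[OF adm] by (intro mult_left_mono) (auto simp: less_imp_le)
    \<comment> \<open>Replacing \<open>\<alpha> i\<close> by its lower bound \<open>\<mu> i\<close>
      removes the dependence on the run of the method.\<close>
    also have "\<dots> \<le> 1 / \<mu> i * ((norm (gradient (f i) c) + Lc i * D) * K)"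
    proof (intro mult_right_mono frac_le)
      show "\<mu> i \<le> \<alpha> i" using adm i by (simp add: admissible_def)
      show "0 \<le> (norm (gradient (f i) c) + Lc i * D) * K"
        using Lc[OF i] D(1) w(3) norm_ge_zero[of w] norm_ge_zero[of "x - c"]
        by (metis (no_types, lifting) add_nonneg_nonneg mult_nonneg_nonneg norm_ge_zero order_trans)
    qed (use \<open>l i \<le> 1\<close> \<mu>_pos[OF i] in auto)
    finally show "l i / \<alpha> i * (gradient (f i) x \<bullet> w) \<le> (norm (gradient (f i) c) + Lc i * D) / \<mu> i * K"
      by simp
  qed
  also have "(z - x) \<bullet> w \<le> 2 * D * K"
  proof -
    have "norm (z - x) \<le> 2 * D"
      using norm_triangle_ineq4[of "z - c" "x - c"] D by simp
    then have "norm (z - x) * norm w \<le> 2 * D * K"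
      using w(3) order_trans[OF norm_ge_zero D(1)] by (intro mult_mono) auto
    then show ?thesis using norm_cauchy_schwarz order_trans by blast
  qed
  finally have "sum l \<L> / \<alpha>min \<le> (\<Sum>i\<in>- \<L>. (norm (gradient (f i) c) + Lc i * D) / \<mu> i * K) + 2 * D * K"
    by simp
  also have "\<dots> = K * ((\<Sum>i\<in>- \<L>. (norm (gradient (f i) c) + Lc i * D) / \<mu> i) + 2 * D)"
    unfolding sum_distrib_right[symmetric] by (simp only: distrib_left ac_simps)
  finally show ?thesis using \<alpha>min_pos by (simp add: divide_le_eq)
qed

end

subsection \<open>Convergence\<close>

lemma abbpgmo_sequence_step:
  "abbpgmo_sequence X f \<tau> \<alpha>min \<alpha>max xm1 x0 x \<Longrightarrow>
    abbpgmo_step X f \<tau> \<alpha>min \<alpha>max (case k of 0 \<Rightarrow> xm1 | Suc j \<Rightarrow> x j) (x k) (x (Suc k))"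
  by (simp add: abbpgmo_sequence_def)

context partly_linear_problem
begin

lemma abbpgmo_iterates:
  assumes seq: "abbpgmo_sequence X f \<tau> \<alpha>min \<alpha>max xm1 x0 x" and x0: "x0 \<in> X" "xm1 \<noteq> x0"
  shows "x k \<in> X" and "\<exists>\<alpha> l. multiplier_step (x k) (x (Suc k)) \<alpha> l" and "f i (x (Suc k)) \<le> f i (x k)"
proof -
  \<comment> \<open>Distinctness of consecutive points is carried along with feasibility, since each
    step's coefficients are admissible only if the previous two points differ.\<close>
  have inv: "x k \<in> X \<and> (case k of 0 \<Rightarrow> xm1 | Suc j \<Rightarrow> x j) \<noteq> x k" for k
  proof (induction k)
    case 0
    then show ?case using seq x0 by (simp add: abbpgmo_sequence_def)
  next
    case (Suc k)
    note step = abbpgmo_step_multipliers[OF abbpgmo_sequence_step[OF seq, of k] conjunct1[OF Suc] conjunct2[OF Suc]]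
    have "\<not> pareto_critical X f (x k)" using seq by (simp add: abbpgmo_sequence_def)
    then have "x (Suc k) \<noteq> x k" by (rule step(3))
    moreover have "x (Suc k) \<in> X" using step(1) by (auto simp: multiplier_step_def)
    ultimately show ?case by simp
  qed
  note step = abbpgmo_step_multipliers[OF abbpgmo_sequence_step[OF seq, of k] conjunct1[OF inv] conjunct2[OF inv]]
  show "x k \<in> X" using inv by blast
  show "\<exists>\<alpha> l. multiplier_step (x k) (x (Suc k)) \<alpha> l" by (rule step(1))
  show "f i (x (Suc k)) \<le> f i (x k)" by (rule step(2))
qed

lemma abbpgmo_bounded:
  assumes seq: "abbpgmo_sequence X f \<tau> \<alpha>min \<alpha>max xm1 x0 x" and x0: "x0 \<in> X" "xm1 \<noteq> x0"
    and j: "j \<notin> \<L>"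
  shows "norm (x k - x0) \<le> 2 * norm (gradient (f j) x0) / \<mu> j"
proof (rule strongly_convex_sublevel_bounded[OF strongly_convex_f[OF j] \<mu>_pos[OF j]])
  have "decseq (\<lambda>k. f j (x k))"
    using abbpgmo_iterates(3)[OF assms(1-3)] by (intro decseq_SucI)
  then have "f j (x k) \<le> f j (x 0)" by (auto simp: decseq_def)
  then show "f j (x k) \<le> f j x0" using seq by (simp add: abbpgmo_sequence_def)
qed

text \<open>By monotonicity a cluster point lies below all iterates in every objective, so the
  function terms of the basic inequality have a favourable sign and the distances to it never
  increase. One subsequence approaching it then draws in the whole sequence.\<close>

lemma abbpgmo_converges:
  assumes seq: "abbpgmo_sequence X f \<tau> \<alpha>min \<alpha>max xm1 x0 x" and x0: "x0 \<in> X" "xm1 \<noteq> x0"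
    and nonlinear: "- \<L> \<noteq> {}"
  obtains xs where "x \<longlonglongrightarrow> xs" "xs \<in> X" "\<And>i k. f i xs \<le> f i (x k)"
proof -
  note iter = abbpgmo_iterates[OF seq x0]
  obtain j where j: "j \<notin> \<L>" using nonlinear by auto
  define D where "D = 2 * norm (gradient (f j) x0) / \<mu> j"
  have "x k \<in> cball x0 D" for k
    using abbpgmo_bounded[OF seq x0 j] by (simp add: D_def dist_norm norm_minus_commute)
  then obtain xs r where r: "strict_mono r" "(x \<circ> r) \<longlonglongrightarrow> xs"
    using compact_cball[of x0 D] unfolding compact_def by blast
  have xs: "xs \<in> X" using closed_sequentially[OF closed_X _ r(2)] iter(1) by simp
  have dec: "decseq (\<lambda>k. f i (x k))" for i
    using iter(3) by (intro decseq_SucI)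
  have f_le: "f i xs \<le> f i (x k)" for i k
  proof -
    have "(\<lambda>n. f i ((x \<circ> r) n)) \<longlonglongrightarrow> f i xs"
      by (rule isCont_tendsto_compose[OF isCont_f r(2)])
    moreover have "decseq (\<lambda>n. f i ((x \<circ> r) n))"
      using dec[of i] r(1) by (auto simp: decseq_def strict_mono_less_eq)
    ultimately have "f i xs \<le> f i ((x \<circ> r) k)" using decseq_ge by blast
    also have "\<dots> \<le> f i (x k)"
      using dec[of i] seq_suble[OF r(1), of k] by (simp add: decseq_def)
    finally show ?thesis .
  qed
  have fejer: "norm (x (Suc k) - xs) \<le> norm (x k - xs)" for k
  proof -
    obtain \<alpha> l where step: "multiplier_step (x k) (x (Suc k)) \<alpha> l" using iter(2) by blast
    then have "admissible \<alpha>" by (simp add: multiplier_step_def)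
    then have "norm (x (Suc k) - xs) \<le> sqrt (1 - (1 - sum l \<L>) * 0) * norm (x k - xs)"
      using \<mu>_pos admissible_pos
      by (intro multiplier_step_contraction[OF step xs f_le]) (auto simp: less_imp_le)
    then show ?thesis by simp
  qed
  have "x \<longlonglongrightarrow> xs"
  proof (rule metric_LIMSEQ_I)
    fix e :: real assume "0 < e"
    then obtain n where "dist ((x \<circ> r) n) xs < e"
      using metric_LIMSEQ_D[OF r(2)] by blast
    moreover have "norm (x k - xs) \<le> norm (x (r n) - xs)" if "r n \<le> k" for k
      using fejer that lift_Suc_antimono_le[of "\<lambda>k. norm (x k - xs)"] by blast
    ultimately show "\<exists>m. \<forall>k\<ge>m. dist (x k) xs < e"
      by (intro exI[of _ "r n"]) (auto simp: dist_norm intro: le_less_trans)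
  qed
  then show thesis using that xs f_le by blast
qed

text \<open>A point \<open>y\<close> beating the limit in every objective by some \<open>\<epsilon>\<close> would attract the iterates:
  their squared distance to \<open>y\<close> would drop by at least \<open>2 \<epsilon> / M\<close> in each step,
  where \<open>M\<close> bounds the coefficients.\<close>

lemma abbpgmo_limit_weakly_pareto:
  assumes seq: "abbpgmo_sequence X f \<tau> \<alpha>min \<alpha>max xm1 x0 x" and x0: "x0 \<in> X" "xm1 \<noteq> x0"
    and xs: "xs \<in> X" "\<And>i k. f i xs \<le> f i (x k)"
  shows "weakly_pareto X UNIV f xs"
  unfolding weakly_pareto_def
proof (intro conjI notI xs(1))
  assume "\<exists>y\<in>X. \<forall>i\<in>UNIV. f i y < f i xs"
  then obtain y where y: "y \<in> X" "\<And>i. f i y < f i xs" by auto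
  define e where "e = (MIN i. f i xs - f i y)"
  have "0 < e" unfolding e_def using y(2) by (subst Min_gr_iff) auto
  have e_le: "e \<le> f i xs - f i y" for i unfolding e_def by (rule Min_le) auto
  \<comment> \<open>\<open>\<alpha>min\<close> is inserted to cover the coefficients of the linear
    objectives.\<close>
  define M where "M = Max (insert \<alpha>min (range (\<lambda>i. \<tau> * Lc i)))"
  have "0 < M" using \<alpha>min_pos by (auto simp: M_def Max_gr_iff)
  have drop: "(norm (x (Suc k) - y))\<^sup>2 \<le> (norm (x k - y))\<^sup>2 - 2 * e / M" for k
  proof -
    obtain \<alpha> l where step: "multiplier_step (x k) (x (Suc k)) \<alpha> l"
      using abbpgmo_iterates(2)[OF seq x0] by blast
    then have adm: "admissible \<alpha>" and l: "\<And>i. 0 \<le> l i" "sum l UNIV = 1"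
      by (auto simp: multiplier_step_def)
    have "\<alpha> i \<le> M" for i
    proof (cases "i \<in> \<L>")
      case False
      then have "\<alpha> i \<le> \<tau> * Lc i" using adm by (simp add: admissible_def)
      also have "\<dots> \<le> M" unfolding M_def by (rule Max_ge) auto
      finally show ?thesis .
    qed (use adm in \<open>auto simp: admissible_def M_def\<close>)
    then have "l i / M * e \<le> l i / \<alpha> i * (f i (x (Suc k)) - f i y)" for i
      using l(1)[of i] admissible_pos[OF adm, of i] e_le[of i] xs(2)[of i "Suc k"] \<open>0 < e\<close> \<open>0 < M\<close>
      by (intro mult_mono frac_le) auto
    then have "(\<Sum>i\<in>UNIV. l i / M * e) \<le> (\<Sum>i\<in>UNIV. l i / \<alpha> i * (f i (x (Suc k)) - f i y))"
      by (intro sum_mono)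
    moreover have "(\<Sum>i\<in>UNIV. l i / M * e) = e / M"
      by (simp only: sum_distrib_right[symmetric] sum_divide_distrib[symmetric] l(2)) simp
    moreover have "0 \<le> (\<Sum>i\<in>- \<L>. l i * (\<mu> i / \<alpha> i)) * (norm (x k - y))\<^sup>2"
      using l(1) \<mu>_pos admissible_pos[OF adm]
      by (intro mult_nonneg_nonneg sum_nonneg) (auto simp: less_imp_le)
    ultimately show ?thesis
      using multiplier_step_fejer[OF step y(1)] by (simp add: left_diff_distrib)
  qed
  have le: "(norm (x k - y))\<^sup>2 \<le> (norm (x 0 - y))\<^sup>2 - real k * (2 * e / M)" for k
  proof (induction k)
    case (Suc k)
    have "real (Suc k) * (2 * e / M) = real k * (2 * e / M) + 2 * e / M"
      by (simp add: distrib_right add_divide_distrib)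
    then show ?case using drop[of k] Suc by linarith
  qed simp
  obtain k where "(norm (x 0 - y))\<^sup>2 < real k * (2 * e / M)"
    using reals_Archimedean3[of "2 * e / M"] \<open>0 < e\<close> \<open>0 < M\<close> by (auto simp: divide_pos_pos)
  then show False using le[of k] zero_le_power2[of "norm (x k - y)"] by linarith
qed

end

subsection \<open>Polyhedra and the rate\<close>

lemma closed_polyhedral_set: "closed (polyhedral_set A a B b)"
proof -
  have "polyhedral_set A a B b = (\<Inter>j. {x. (A *v x) $ j \<le> a $ j}) \<inter> {x. B *v x = b}"
    by (auto simp: polyhedral_set_def less_eq_vec_def)
  moreover have "closed {x. (A *v x) $ j \<le> a $ j}" for j
    by (intro closed_Collect_le continuous_intros)
  moreover have "closed {x. B *v x = b}"
    by (intro closed_Collect_eq continuous_intros)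
  ultimately show ?thesis by (simp add: closed_Int closed_INT)
qed

lemma convex_polyhedral_set: "convex (polyhedral_set A a B b)"
proof (rule convexI)
  fix x y and u v :: real
  assume xy: "x \<in> polyhedral_set A a B b" "y \<in> polyhedral_set A a B b" and uv: "0 \<le> u" "0 \<le> v" "u + v = 1"
  have "u *\<^sub>R (A *v x) + v *\<^sub>R (A *v y) \<le> u *\<^sub>R a + v *\<^sub>R a"
    using xy uv by (auto simp: polyhedral_set_def less_eq_vec_def intro!: add_mono mult_left_mono)
  also have "\<dots> = a" using uv by (simp add: scaleR_left_distrib[symmetric])
  moreover have "u *\<^sub>R b + v *\<^sub>R b = b" using uv by (simp add: scaleR_left_distrib[symmetric])
  ultimately show "u *\<^sub>R x + v *\<^sub>R y \<in> polyhedral_set A a B b"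
    using xy by (simp add: polyhedral_set_def matrix_vector_right_distrib matrix_vector_mult_scaleR)
qed

text \<open>The set of feasible directions at a point of a polyhedron depends only on which inequalities are
  active there, so finitely many descent directions suffice for all points.\<close>

lemma polyhedral_uniform_descent_direction:
  fixes f :: "'m::finite \<Rightarrow> real^'n \<Rightarrow> real" and A :: "real^'n^'p" and B :: "real^'n^'q"
  assumes lin: "\<And>i. i \<in> I \<Longrightarrow> linear (f i)"
  shows "\<exists>K>0. \<forall>y\<in>polyhedral_set A a B b. \<not> weakly_pareto (polyhedral_set A a B b) I f y \<longrightarrow>
    (\<exists>w t. 0 < t \<and> y + t *\<^sub>R w \<in> polyhedral_set A a B b \<and> norm w \<le> K \<and> (\<forall>i\<in>I. f i w \<le> - 1))"
proof -
  define P where "P J w \<longleftrightarrow> (\<forall>j\<in>J. (A *v w) $ j \<le> 0) \<and> B *v w = 0 \<and> (\<forall>i\<in>I. f i w \<le> - 1)" for J w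
  \<comment> \<open>For index sets \<open>J\<close> without such a direction, \<open>W J\<close> is
    an arbitrary vector; it merely enlarges \<open>K\<close>.\<close>
  define W where "W J = (SOME w. P J w)" for J
  define K where "K = 1 + (\<Sum>J\<in>UNIV. norm (W J))"
  have W_le: "norm (W J) \<le> K" for J
    using member_le_sum[of J UNIV "\<lambda>J. norm (W J)"] by (simp add: K_def)
  have "0 < K" unfolding K_def by (intro add_pos_nonneg sum_nonneg) auto
  moreover have "\<exists>w t. 0 < t \<and> y + t *\<^sub>R w \<in> polyhedral_set A a B b \<and> norm w \<le> K \<and> (\<forall>i\<in>I. f i w \<le> - 1)"
    if y: "y \<in> polyhedral_set A a B b" and not_wp: "\<not> weakly_pareto (polyhedral_set A a B b) I f y" for y
  proof -
    define J where "J = {j. (A *v y) $ j = a $ j}"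
    obtain x where x: "x \<in> polyhedral_set A a B b" "\<And>i. i \<in> I \<Longrightarrow> f i x < f i y"
      using y not_wp by (auto simp: weakly_pareto_def)
    \<comment> \<open>The smallest decrease over \<open>I\<close>, capped at 1 so that the minimum
      is defined for empty \<open>I\<close>. Dividing \<open>x - y\<close> by \<open>e\<close> makes
      every linear objective drop by at least 1.\<close>
    define e where "e = Min (insert 1 ((\<lambda>i. f i y - f i x) ` I))"
    have "0 < e" using x(2) by (auto simp: e_def)
    have e_le: "e \<le> f i y - f i x" if "i \<in> I" for i
      unfolding e_def using that by (intro Min_le) auto
    have "P J ((1 / e) *\<^sub>R (x - y))"
      unfolding P_def
    proof (intro conjI ballI)
      fix j assume "j \<in> J"
      then have "(A *v x) $ j - (A *v y) $ j \<le> 0"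
        using x(1) by (simp add: J_def polyhedral_set_def less_eq_vec_def)
      then show "(A *v ((1 / e) *\<^sub>R (x - y))) $ j \<le> 0"
        using \<open>0 < e\<close> by (simp add: matrix_vector_mult_scaleR matrix_vector_mult_diff_distrib divide_le_0_iff)
    next
      show "B *v ((1 / e) *\<^sub>R (x - y)) = 0"
        using x(1) y by (simp add: matrix_vector_mult_scaleR matrix_vector_mult_diff_distrib polyhedral_set_def)
    next
      fix i assume i: "i \<in> I"
      have "f i ((1 / e) *\<^sub>R (x - y)) = (f i x - f i y) / e"
        by (simp add: linear_cmul[OF lin[OF i]] linear_diff[OF lin[OF i]])
      then show "f i ((1 / e) *\<^sub>R (x - y)) \<le> - 1"
        using e_le[OF i] \<open>0 < e\<close> by (simp add: divide_le_eq)
    qed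
    then have W: "P J (W J)" unfolding W_def by (rule someI)
    \<comment> \<open>Active constraints do not increase along \<open>W J\<close>; inactive ones
      keep their slack for small \<open>t\<close> by continuity.\<close>
    have "\<forall>\<^sub>F t in at_right 0. (A *v y) $ j + t * (A *v W J) $ j \<le> a $ j" for j
    proof (cases "j \<in> J")
      case True
      then have "(A *v W J) $ j \<le> 0" using W by (simp add: P_def)
      with True show ?thesis
        by (intro eventually_at_right_less[THEN eventually_mono]) (simp add: J_def mult_le_0_iff)
    next
      case False
      then have inactive: "(A *v y) $ j + 0 * (A *v W J) $ j < a $ j"
        using y by (simp add: J_def polyhedral_set_def less_eq_vec_def order_less_le)
      have "((\<lambda>t. (A *v y) $ j + t * (A *v W J) $ j) \<longlongrightarrow> (A *v y) $ j + 0 * (A *v W J) $ j) (at_right 0)"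
        by (intro tendsto_intros)
      then have "\<forall>\<^sub>F t in at_right 0. (A *v y) $ j + t * (A *v W J) $ j < a $ j"
        using inactive by (rule order_tendstoD(2))
      then show ?thesis by (rule eventually_mono) simp
    qed
    then have "\<forall>\<^sub>F t in at_right 0. \<forall>j. (A *v y) $ j + t * (A *v W J) $ j \<le> a $ j"
      by (rule eventually_all_finite)
    then have "\<forall>\<^sub>F t in at_right (0::real). 0 < t \<and> (\<forall>j. (A *v y) $ j + t * (A *v W J) $ j \<le> a $ j)"
      using eventually_at_right_less by (rule eventually_conj[rotated])
    then obtain t where t: "0 < t" "\<And>j. (A *v y) $ j + t * (A *v W J) $ j \<le> a $ j"
      using eventually_happens'[OF trivial_limit_at_right_real] by blast
    have "y + t *\<^sub>R W J \<in> polyhedral_set A a B b"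
      using y t(2) W
      by (simp add: P_def polyhedral_set_def less_eq_vec_def matrix_vector_right_distrib matrix_vector_mult_scaleR)
    with t(1) W_le[of J] W show ?thesis unfolding P_def by blast
  qed
  ultimately show ?thesis by blast
qed

text \<open>Quantifying \<open>C\<close> before \<open>\<alpha>min\<close> and the sequence
  expresses that it does not depend on \<open>\<alpha>min\<close>.\<close>

theorem proposition4p2:
  fixes A :: "real^'n^'p" and a :: "real^'p" and B :: "real^'n^'q" and b :: "real^'q"
    and X :: "(real^'n) set"
    and f :: "'m::finite \<Rightarrow> real^'n \<Rightarrow> real"
    and \<L> :: "'m set"
    and \<mu> Lc :: "'m \<Rightarrow> real"
    and \<tau> \<alpha>max :: real
    and x0 xm1 :: "real^'n"
  assumes "X = polyhedral_set A a B b"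
    and "\<L> \<noteq> {}" and "- \<L> \<noteq> {}"
    and "\<And>i. i \<in> \<L> \<Longrightarrow> linear (f i)"
    and "\<And>i. i \<notin> \<L> \<Longrightarrow> \<mu> i > 0"
    and "\<And>i. i \<notin> \<L> \<Longrightarrow> strongly_convex (\<mu> i) (f i)"
    and "\<And>i. i \<notin> \<L> \<Longrightarrow> L_smooth (Lc i) (f i)"
    and "\<tau> > 1"
    and "\<alpha>max \<ge> (MAX i\<in>- \<L>. Lc i)"
    and "x0 \<in> X" and "xm1 \<noteq> x0"
  shows "\<exists>C>0. \<forall>\<alpha>min x.
    0 < \<alpha>min \<and> \<alpha>min < \<alpha>max \<and> \<alpha>min \<le> (MIN i\<in>- \<L>. \<mu> i) \<and>
    abbpgmo_sequence X f \<tau> \<alpha>min \<alpha>max xm1 x0 x \<longrightarrow>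
    (\<exists>xs. x \<longlonglongrightarrow> xs \<and> weakly_pareto X UNIV f xs \<and>
      (\<not> weakly_pareto X \<L> f xs \<longrightarrow>
        (\<forall>k. norm (x (Suc k) - xs) \<le>
          sqrt (1 - (1 - C * \<alpha>min) * (MIN i\<in>- \<L>. \<mu> i / (\<tau> * Lc i))) * norm (x k - xs))))"
proof -
  note X = assms(1) and \<mu>_pos = assms(5) and sc = assms(6) and sm = assms(7) and x0 = assms(10,11)
  obtain K where K: "0 < K" and dir: "\<forall>y\<in>X. \<not> weakly_pareto X \<L> f y \<longrightarrow>
      (\<exists>w t. 0 < t \<and> y + t *\<^sub>R w \<in> X \<and> norm w \<le> K \<and> (\<forall>i\<in>\<L>. f i w \<le> - 1))"
    unfolding X using polyhedral_uniform_descent_direction[of \<L> f A a B b] assms(4) by auto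
  obtain j where j: "j \<notin> \<L>" using assms(3) by auto
  \<comment> \<open>Comparing the two bounds on the quotient at the distinct points
    \<open>xm1\<close> and \<open>x0\<close> gives \<open>\<mu> i \<le> Lc i\<close>.\<close>
  have Lc_pos: "0 < Lc i" if "i \<notin> \<L>" for i
    using strongly_convex_smooth_inner_bounds[OF sc[OF that] sm[OF that] x0(2)] \<mu>_pos[OF that] by linarith
  define D where "D = 2 * norm (gradient (f j) x0) / \<mu> j"
  have "0 \<le> D" using \<mu>_pos[OF j] by (simp add: D_def)
  \<comment> \<open>The constant from \<open>sum_linear_multipliers_le\<close> with centre
    \<open>x0\<close>; it is built from the problem data and \<open>x0\<close> alone.\<close>
  define R where "R = K * ((\<Sum>i\<in>- \<L>. (norm (gradient (f i) x0) + Lc i * D) / \<mu> i) + 2 * D)"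
  have "0 \<le> R"
    unfolding R_def using K Lc_pos \<mu>_pos \<open>0 \<le> D\<close>
    by (intro mult_nonneg_nonneg add_nonneg_nonneg sum_nonneg divide_nonneg_nonneg) (auto simp: less_imp_le)
  show ?thesis
  \<comment> \<open>\<open>R\<close> is only known to be nonnegative, so 1 is added to obtain a
    positive constant.\<close>
  proof (intro exI[of _ "R + 1"] conjI allI impI)
    show "0 < R + 1" using \<open>0 \<le> R\<close> by simp
    fix \<alpha>min x
    assume "0 < \<alpha>min \<and> \<alpha>min < \<alpha>max \<and> \<alpha>min \<le> (MIN i\<in>- \<L>. \<mu> i) \<and>
      abbpgmo_sequence X f \<tau> \<alpha>min \<alpha>max xm1 x0 x"
    then have \<alpha>min: "0 < \<alpha>min" "\<alpha>min \<le> (MIN i\<in>- \<L>. \<mu> i)"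
      and seq: "abbpgmo_sequence X f \<tau> \<alpha>min \<alpha>max xm1 x0 x" by auto
    have \<alpha>min_le: "\<alpha>min \<le> \<mu> i" if "i \<notin> \<L>" for i
      using that by (intro order_trans[OF \<alpha>min(2)] Min_le) auto
    have \<alpha>max_ge: "Lc i \<le> \<alpha>max" if "i \<notin> \<L>" for i
      using that by (intro order_trans[OF _ assms(9)] Max_ge) auto
    interpret partly_linear_problem X f \<L> \<mu> Lc \<tau> \<alpha>min \<alpha>max
      by (rule partly_linear_problem.intro)
        (use assms(4,8) \<mu>_pos sc sm \<alpha>min(1) \<alpha>min_le \<alpha>max_ge in
          \<open>simp_all add: X closed_polyhedral_set convex_polyhedral_set\<close>)
    obtain xs where lim: "x \<longlonglongrightarrow> xs" and xs: "xs \<in> X" and f_le: "\<And>i k. f i xs \<le> f i (x k)"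
      by (rule abbpgmo_converges[OF seq x0 assms(3)]) (rule that)
    have "norm (x (Suc k) - xs) \<le>
        sqrt (1 - (1 - (R + 1) * \<alpha>min) * (MIN i\<in>- \<L>. \<mu> i / (\<tau> * Lc i))) * norm (x k - xs)"
      if not_wp: "\<not> weakly_pareto X \<L> f xs" for k
    proof -
      obtain \<alpha> l where step: "multiplier_step (x k) (x (Suc k)) \<alpha> l"
        using abbpgmo_iterates(2)[OF seq x0] by blast
      \<comment> \<open>A point that beats the limit in all linear objectives also beats every
        iterate, so a descent direction of norm at most \<open>K\<close> exists at each of
        them.\<close>
      have "\<not> weakly_pareto X \<L> f (x (Suc k))"
        using not_wp xs f_le unfolding weakly_pareto_def by (meson less_le_trans)
      then obtain w t where w: "0 < t" "x (Suc k) + t *\<^sub>R w \<in> X" "norm w \<le> K" "\<And>i. i \<in> \<L> \<Longrightarrow> f i w \<le> - 1"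
        using dir abbpgmo_iterates(1)[OF seq x0, of "Suc k"] by blast
      have "sum l \<L> \<le> R * \<alpha>min"
        unfolding R_def
        using abbpgmo_bounded[OF seq x0 j] Lc_pos
        by (intro sum_linear_multipliers_le[OF step w(2,1,3,4)]) (auto simp: D_def less_imp_le)
      also have "\<dots> \<le> (R + 1) * \<alpha>min" using \<alpha>min(1) by simp
      finally have s: "sum l \<L> \<le> (R + 1) * \<alpha>min" .
      show ?thesis
      proof (rule multiplier_step_contraction[OF step xs f_le _ _ s])
        show "0 \<le> (MIN i\<in>- \<L>. \<mu> i / (\<tau> * Lc i))"
          using assms(3,8) \<mu>_pos Lc_pos by (subst Min_ge_iff) (auto simp: less_imp_le)
        fix i assume i: "i \<notin> \<L>"
        have adm: "admissible \<alpha>" using step by (simp add: multiplier_step_def)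
        have "(MIN i\<in>- \<L>. \<mu> i / (\<tau> * Lc i)) \<le> \<mu> i / (\<tau> * Lc i)"
          using i by (intro Min_le) auto
        also have "\<dots> \<le> \<mu> i / \<alpha> i"
          using adm i \<mu>_pos[OF i] admissible_pos[OF adm, of i]
          by (intro frac_le) (auto simp: admissible_def)
        finally show "(MIN i\<in>- \<L>. \<mu> i / (\<tau> * Lc i)) \<le> \<mu> i / \<alpha> i" .
      qed
    qed
    with lim abbpgmo_limit_weakly_pareto[OF seq x0 xs f_le]
    show "\<exists>xs. x \<longlonglongrightarrow> xs \<and> weakly_pareto X UNIV f xs \<and>
      (\<not> weakly_pareto X \<L> f xs \<longrightarrow>
        (\<forall>k. norm (x (Suc k) - xs) \<le>
          sqrt (1 - (1 - (R + 1) * \<alpha>min) * (MIN i\<in>- \<L>. \<mu> i / (\<tau> * Lc i))) * norm (x k - xs)))"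
      by blast
  qed
qed

end
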